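(* Let $\mathcal X=\prod_{i\in[n]}\mathcal X_i$ with $\mathcal X_i$ continuous sets, let $T>0$, let $f:\mathcal X\to\mathbb R$ be continuous with $f(\mathcal X)\subseteq[-T,T]$, and let $\epsilon>0$. Let $p(y|x)$ be the Gaussian privacy channel of $f$ with parameter $N>0$, i.e. for each $x\in\mathcal X$ the output distribution $p(\cdot|x)$ is the normal distribution $\mathcal N(f(x),N)$ with mean $f(x)$ and variance $N$. If $$N\ge\frac{T^2}{\exp(2\epsilon)-1},$$ then the Gaussian privacy channel satisfies $\epsilon$-information privacy with respect to $\mathbb P$.
   Context: $n\ge1$, $[n]=\{1,\dots,n\}$. "Continuous sets" $\mathcal X_i$ are Borel subsets of Euclidean spaces. All logarithms (in particular in mutual information) are natural. $\mathbb P$ is the set of all probability distributions on $\mathcal X$. For $X=(X_1,\dots,X_n)$ with distribution in $\mathbb P$, $Y$ is the real-valued output of the channel on input $X$ (conditionally on $X=x$, $Y\sim\mathcal N(f(x),N)$). The individual channel capacity with respect to $\mathbb P$ is $C_1=\max_{i\in[n],X\in\mathbb P}I(X_i;Y)$, with $I$ the mutual information. The channel satisfies $\epsilon$-information privacy with respect to $\mathbb P$ if $C_1\le\epsilon$, i.e. if $I(X_i;Y)\le\epsilon$ for all $i\in[n]$ and all $X\in\mathbb P$. *)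

theory Defs
  imports "HOL-Probability.Probability"
begin

definition borel_Euclidean :: "nat \<Rightarrow> (nat \<Rightarrow> real) measure" where
  "borel_Euclidean d =
     sigma (topspace (Euclidean_space d)) {U. openin (Euclidean_space d) U}"

(* The alphabets may live in Euclidean spaces of different dimensions: X i is a subset of R^(d i). *)

definition input_alphabet :: "nat \<Rightarrow> (nat \<Rightarrow> (nat \<Rightarrow> real) set) \<Rightarrow> (nat \<Rightarrow> nat \<Rightarrow> real) set" where
  "input_alphabet n X = (\<Pi>\<^sub>E i\<in>{1..n}. X i)"

definition input_topology ::
    "nat \<Rightarrow> (nat \<Rightarrow> nat) \<Rightarrow> (nat \<Rightarrow> (nat \<Rightarrow> real) set) \<Rightarrow> (nat \<Rightarrow> nat \<Rightarrow> real) topology" where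
  "input_topology n d X =
     product_topology (\<lambda>i. subtopology (Euclidean_space (d i)) (X i)) {1..n}"

definition coordinate_space ::
    "(nat \<Rightarrow> nat) \<Rightarrow> (nat \<Rightarrow> (nat \<Rightarrow> real) set) \<Rightarrow> nat \<Rightarrow> (nat \<Rightarrow> real) measure" where
  "coordinate_space d X i = restrict_space (borel_Euclidean (d i)) (X i)"

definition all_distributions ::
    "nat \<Rightarrow> (nat \<Rightarrow> 'a measure) \<Rightarrow> (nat \<Rightarrow> 'a) measure set" where
  "all_distributions n S = {P. prob_space P \<and> sets P = sets (\<Pi>\<^sub>M i\<in>{1..n}. S i)}"

(* The joint law of input and output, for input law P and channel (probability kernel) K. *)

definition channel_law :: "'a measure \<Rightarrow> ('a \<Rightarrow> real measure) \<Rightarrow> ('a \<times> real) measure" where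
  "channel_law P K = do {x \<leftarrow> P; y \<leftarrow> K x; return (P \<Otimes>\<^sub>M borel) (x, y)}"

(* The library's mutual information is a Bochner integral, hence 0 when the integral diverges, and
   it carries no information without absolute continuity.  As the negative part of the integrand is
   always integrable, the true value in both of these cases is infinity.  Base exp 1 gives the
   natural logarithm. *)

definition ext_mutual_information ::
    "'w measure \<Rightarrow> 'b measure \<Rightarrow> 'c measure \<Rightarrow> ('w \<Rightarrow> 'b) \<Rightarrow> ('w \<Rightarrow> 'c) \<Rightarrow> ereal" where
  "ext_mutual_information M S T U V =
     (let P = distr M S U \<Otimes>\<^sub>M distr M T V;
          Q = distr M (S \<Otimes>\<^sub>M T) (\<lambda>\<omega>. (U \<omega>, V \<omega>))
      in if absolutely_continuous P Q \<and> integrable Q (entropy_density (exp 1) P Q)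
         then ereal (prob_space.mutual_information M (exp 1) S T U V)
         else \<infinity>)"

(* A supremum, since a maximum need not be attained. *)

definition individual_capacity ::
    "nat \<Rightarrow> (nat \<Rightarrow> 'a measure) \<Rightarrow> (nat \<Rightarrow> 'a) measure set \<Rightarrow> ((nat \<Rightarrow> 'a) \<Rightarrow> real measure) \<Rightarrow> ereal" where
  "individual_capacity n S PP K =
     (SUP (i, P) \<in> {1..n} \<times> PP.
        ext_mutual_information (channel_law P K) (S i) borel (\<lambda>(x, y). x i) (\<lambda>(x, y). y))"

definition information_private ::
    "real \<Rightarrow> nat \<Rightarrow> (nat \<Rightarrow> 'a measure) \<Rightarrow> (nat \<Rightarrow> 'a) measure set \<Rightarrow> ((nat \<Rightarrow> 'a) \<Rightarrow> real measure) \<Rightarrow> bool" where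
  "information_private \<epsilon> n S PP K \<longleftrightarrow> individual_capacity n S PP K \<le> ereal \<epsilon>"

(* N is the variance, whereas normal_density expects the standard deviation. *)

definition gaussian_channel :: "('a \<Rightarrow> real) \<Rightarrow> real \<Rightarrow> 'a \<Rightarrow> real measure" where
  "gaussian_channel f N x = density lborel (\<lambda>y. ennreal (normal_density (f x) (sqrt N) y))"

end

(* For any output density q, the bound ln t <= t - 1 applied to t = r q / p, where p is the channel
   density and r the density of the law of (X_i, Y) with respect to the product of its marginals,
   yields I(X_i; Y) <= E ln (p(Y|X) / q(Y)), because E t <= 1.  Bounding the individual information
   by a quantity involving the whole input in one step avoids differential entropies, conditional
   densities and the data processing inequality.  For q = N(0, T^2 + N) the right-hand side is at
   most ln (1 + T^2 / N) / 2, since |f| <= T. *)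

theory Submission
  imports Defs
begin

section \<open>Joint law of input and output as a density\<close>

text \<open>Channel laws are built by monadic bind; as densities over
  \<open>P \<Otimes>\<^sub>M lborel\<close> they turn later expectations into iterated integrals.
  Normalisation of each slice makes \<open>K\<close> a probability kernel, after which the binds can
  be evaluated on sets.\<close>

lemma channel_law_density:
  fixes \<phi> :: "'a \<times> real \<Rightarrow> real"
  assumes "prob_space P"
    and \<phi>[measurable]: "\<phi> \<in> borel_measurable (P \<Otimes>\<^sub>M lborel)"
    and K: "\<And>x. x \<in> space P \<Longrightarrow> K x = density lborel (\<lambda>y. ennreal (\<phi> (x, y)))"
    and norm: "\<And>x. x \<in> space P \<Longrightarrow> (\<integral>\<^sup>+y. ennreal (\<phi> (x, y)) \<partial>lborel) = 1"
  shows "channel_law P K = density (P \<Otimes>\<^sub>M lborel) (\<lambda>z. ennreal (\<phi> z))"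
proof -
  interpret P: prob_space P by fact
  have \<phi>x[measurable]: "(\<lambda>y. \<phi> (x, y)) \<in> borel_measurable borel" if "x \<in> space P" for x
    using measurable_compose[OF measurable_Pair1'[OF that] \<phi>] by simp
  have prob: "prob_space (K x)" if "x \<in> space P" for x
    using that norm[OF that] by (auto intro!: prob_spaceI simp: K emeasure_density)
  have sets_K: "sets (K x) = sets borel" if "x \<in> space P" for x
    using that by (simp add: K)
  have K_meas[measurable]: "K \<in> P \<rightarrow>\<^sub>M subprob_algebra borel"
  proof (rule measurable_subprob_algebra)
    fix A :: "real set" assume [measurable]: "A \<in> sets borel"
    have "(\<lambda>x. \<integral>\<^sup>+y. ennreal (\<phi> (x, y)) * indicator A y \<partial>lborel) \<in> borel_measurable P"
      by measurable
    then show "(\<lambda>x. emeasure (K x) A) \<in> borel_measurable P"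
      by (rule measurable_cong[THEN iffD1, rotated]) (simp add: K emeasure_density)
  qed (auto simp: sets_K prob prob_space_imp_subprob_space)
  \<comment> \<open>The inner bind only attaches \<open>x\<close> to the output, so it is a
    pushforward under \<open>Pair x\<close>. Non-emptiness is supplied because a bind over an empty
    space collapses by definition to \<open>count_space {}\<close>.\<close>
  have inner: "(K x \<bind> (\<lambda>y. return (P \<Otimes>\<^sub>M borel) (x, y))) = distr (K x) (P \<Otimes>\<^sub>M borel) (Pair x)"
    if "x \<in> space P" for x
    using that prob[OF that, THEN prob_space.not_empty] sets_K[OF that]
    by (intro bind_return_distr') (auto cong: measurable_cong_sets)
  have *: "(\<lambda>x. distr (K x) (P \<Otimes>\<^sub>M borel) (Pair x)) \<in> P \<rightarrow>\<^sub>M subprob_algebra (P \<Otimes>\<^sub>M borel)"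
    by (rule measurable_distr2[where M=borel]) auto
  have law: "channel_law P K = P \<bind> (\<lambda>x. distr (K x) (P \<Otimes>\<^sub>M borel) (Pair x))"
    unfolding channel_law_def by (intro bind_cong refl inner) (simp_all add: simp_implies_def)
  show ?thesis
  proof (rule measure_eqI)
    show sets_eq: "sets (channel_law P K) = sets (density (P \<Otimes>\<^sub>M lborel) (\<lambda>z. ennreal (\<phi> z)))"
      unfolding law by (subst sets_bind[where N="P \<Otimes>\<^sub>M borel"])
        (auto simp: P.not_empty intro!: sets_pair_measure_cong)
    fix A assume "A \<in> sets (channel_law P K)"
    then have A: "A \<in> sets (P \<Otimes>\<^sub>M lborel)" and A'[measurable]: "A \<in> sets (P \<Otimes>\<^sub>M borel)"
      by (auto simp: sets_eq cong: sets_pair_measure_cong)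
    have "emeasure (channel_law P K) A = (\<integral>\<^sup>+x. emeasure (distr (K x) (P \<Otimes>\<^sub>M borel) (Pair x)) A \<partial>P)"
      unfolding law by (rule emeasure_bind[OF P.not_empty * A'])
    also have "\<dots> = (\<integral>\<^sup>+x. \<integral>\<^sup>+y. ennreal (\<phi> (x, y)) * indicator A (x, y) \<partial>lborel \<partial>P)"
    proof (rule nn_integral_cong)
      fix x assume x: "x \<in> space P"
      then have "emeasure (distr (K x) (P \<Otimes>\<^sub>M borel) (Pair x)) A = emeasure (K x) (Pair x -` A)"
        using sets_K[OF x] by (subst emeasure_distr)
          (auto simp: sets_eq_imp_space_eq[OF sets_K[OF x]] cong: measurable_cong_sets)
      also have "\<dots> = (\<integral>\<^sup>+y. ennreal (\<phi> (x, y)) * indicator (Pair x -` A) y \<partial>lborel)"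
        unfolding K[OF x] using x sets_Pair1[OF A', of x] by (intro emeasure_density) auto
      finally show "emeasure (distr (K x) (P \<Otimes>\<^sub>M borel) (Pair x)) A =
          (\<integral>\<^sup>+y. ennreal (\<phi> (x, y)) * indicator A (x, y) \<partial>lborel)"
        by (simp add: indicator_def)
    qed
    also have "\<dots> = (\<integral>\<^sup>+z. ennreal (\<phi> z) * indicator A z \<partial>(P \<Otimes>\<^sub>M lborel))"
      using A by (intro lborel.nn_integral_fst) measurable
    also have "\<dots> = emeasure (density (P \<Otimes>\<^sub>M lborel) (\<lambda>z. ennreal (\<phi> z))) A"
      using A by (simp add: emeasure_density)
    finally show "emeasure (channel_law P K) A = emeasure (density (P \<Otimes>\<^sub>M lborel) (\<lambda>z. ennreal (\<phi> z))) A" .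
  qed
qed

section \<open>Variational upper bound on mutual information\<close>

text \<open>Here \<open>U\<close> is any statistic of the input, later a coordinate. Finiteness is
  part of the claim: absolute continuity and integrability of the entropy density must be
  established first, since otherwise the extended quantity is infinite.\<close>

lemma ext_mutual_information_le:
  fixes \<phi> :: "'a \<times> 'c \<Rightarrow> real" and q :: "'c \<Rightarrow> real"
  assumes "prob_space P" and "sigma_finite_measure L"
    and L[measurable_cong]: "sets L = sets T"
    and U[measurable]: "U \<in> P \<rightarrow>\<^sub>M S"
    and \<phi>[measurable]: "\<phi> \<in> borel_measurable (P \<Otimes>\<^sub>M L)" and \<phi>_pos: "\<And>z. \<phi> z > 0"
    and norm: "\<And>x. x \<in> space P \<Longrightarrow> (\<integral>\<^sup>+y. ennreal (\<phi> (x, y)) \<partial>L) = 1"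
    and q[measurable]: "q \<in> borel_measurable L" and q_pos: "\<And>y. q y > 0"
    and q_le: "(\<integral>\<^sup>+y. ennreal (q y) \<partial>L) \<le> 1"
    and M: "M = density (P \<Otimes>\<^sub>M L) (\<lambda>z. ennreal (\<phi> z))"
    and int: "integrable M (\<lambda>z. ln (\<phi> z / q (snd z)))"
  shows "ext_mutual_information M S T (\<lambda>(x, y). U x) (\<lambda>(x, y). y)
    \<le> ereal (\<integral>z. ln (\<phi> z / q (snd z)) \<partial>M)"
proof -
  interpret P: prob_space P by fact
  interpret L: sigma_finite_measure L by fact
  interpret PL: pair_sigma_finite P L ..
  have sets_M[measurable_cong]: "sets M = sets (P \<Otimes>\<^sub>M L)" by (simp add: M)
  have space_M: "space M = space (P \<Otimes>\<^sub>M L)" by (simp add: M)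
  have nn_M: "(\<integral>\<^sup>+z. h z \<partial>M) = (\<integral>\<^sup>+x. \<integral>\<^sup>+y. ennreal (\<phi> (x, y)) * h (x, y) \<partial>L \<partial>P)"
    if [measurable]: "h \<in> borel_measurable (P \<Otimes>\<^sub>M L)" for h
    unfolding M by (simp add: nn_integral_density L.nn_integral_fst[symmetric])
  interpret M: prob_space M
  proof
    have "emeasure M (space M) = (\<integral>\<^sup>+z. 1 \<partial>M)" by simp
    also have "\<dots> = (\<integral>\<^sup>+x. \<integral>\<^sup>+y. ennreal (\<phi> (x, y)) \<partial>L \<partial>P)"
      by (subst nn_M) auto
    also have "\<dots> = (\<integral>\<^sup>+x. 1 \<partial>P)" by (intro nn_integral_cong norm)
    finally show "emeasure M (space M) = 1" by (simp add: P.emeasure_space_1)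
  qed
  \<comment> \<open>The density of the output with respect to \<open>L\<close>. It is kept in
    \<open>ennreal\<close> because it may be infinite on a null set; positivity on
    \<open>space L\<close> and finiteness almost everywhere are what allow cancelling it.\<close>
  define p where "p y = (\<integral>\<^sup>+x. ennreal (\<phi> (x, y)) \<partial>P)" for y
  have p[measurable]: "p \<in> borel_measurable L"
    unfolding p_def by measurable
  have p_pos: "p y > 0" if "y \<in> space L" for y
  proof (rule ccontr)
    have [measurable]: "(\<lambda>x. \<phi> (x, y)) \<in> borel_measurable P"
      using measurable_compose[OF measurable_Pair2'[OF that] \<phi>] by simp
    assume "\<not> p y > 0"
    then have "AE x in P. ennreal (\<phi> (x, y)) = 0"
      by (subst nn_integral_0_iff_AE[symmetric]) (auto simp: p_def)
    then have "AE x in P. False"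
    proof eventually_elim
      case (elim x)
      then show False using \<phi>_pos[of "(x, y)"] by (simp add: ennreal_eq_0_iff)
    qed
    then show False by simp
  qed
  have "(\<integral>\<^sup>+y. p y \<partial>L) = (\<integral>\<^sup>+x. \<integral>\<^sup>+y. ennreal (\<phi> (x, y)) \<partial>L \<partial>P)"
    unfolding p_def by (intro PL.Fubini) auto
  also have "\<dots> = (\<integral>\<^sup>+x. 1 \<partial>P)" by (intro nn_integral_cong norm)
  finally have "(\<integral>\<^sup>+y. p y \<partial>L) \<noteq> \<infinity>" by (simp add: P.emeasure_space_1)
  then have p_fin: "AE y in L. p y \<noteq> \<infinity>"
    by (intro nn_integral_PInf_AE) auto
  have p_cancel: "AE y in L. p y * (ennreal (q y) / p y) = ennreal (q y)"
    using p_fin AE_space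
  proof eventually_elim
    case (elim y)
    then show ?case
      using p_pos[of y] by (simp add: ennreal_times_divide mult_divide_eq_ennreal mult.commute[of "p y"])
  qed
  have U'[measurable]: "(\<lambda>(x, y). U x) \<in> M \<rightarrow>\<^sub>M S" and V'[measurable]: "(\<lambda>(x, y). y) \<in> M \<rightarrow>\<^sub>M T"
    by measurable
  define \<mu> where "\<mu> = distr M S (\<lambda>(x, y). U x)"
  define \<nu> where "\<nu> = distr M T (\<lambda>(x, y). y)"
  \<comment> \<open>The pair is spelled with two \<open>case\<close> expressions so that it matches
    the instance of \<open>ext_mutual_information\<close> and can be folded into it below.\<close>
  define Q where "Q = distr M (S \<Otimes>\<^sub>M T) (\<lambda>z. (case z of (x, y) \<Rightarrow> U x, case z of (x, y) \<Rightarrow> y))"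
  have [measurable_cong]: "sets \<mu> = sets S" "sets \<nu> = sets T" "sets Q = sets (S \<Otimes>\<^sub>M T)"
    by (simp_all add: \<mu>_def \<nu>_def Q_def)
  interpret \<mu>: prob_space \<mu> unfolding \<mu>_def by (rule M.prob_space_distr) measurable
  interpret \<nu>: prob_space \<nu> unfolding \<nu>_def by (rule M.prob_space_distr) measurable
  interpret Q: prob_space Q unfolding Q_def by (rule M.prob_space_distr) measurable
  interpret \<mu>\<nu>: pair_prob_space \<mu> \<nu> ..
  have nn_\<mu>: "(\<integral>\<^sup>+u. h u \<partial>\<mu>) = (\<integral>\<^sup>+x. h (U x) \<partial>P)" if [measurable]: "h \<in> borel_measurable S" for h
  proof -
    have "(\<integral>\<^sup>+u. h u \<partial>\<mu>) = (\<integral>\<^sup>+z. h (U (fst z)) \<partial>M)"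
      unfolding \<mu>_def by (subst nn_integral_distr) (auto simp: case_prod_beta)
    also have "\<dots> = (\<integral>\<^sup>+x. \<integral>\<^sup>+y. ennreal (\<phi> (x, y)) * h (U x) \<partial>L \<partial>P)"
      by (subst nn_M) auto
    also have "\<dots> = (\<integral>\<^sup>+x. (\<integral>\<^sup>+y. ennreal (\<phi> (x, y)) \<partial>L) * h (U x) \<partial>P)"
      by (intro nn_integral_cong nn_integral_multc) measurable
    also have "\<dots> = (\<integral>\<^sup>+x. h (U x) \<partial>P)"
      by (intro nn_integral_cong) (simp add: norm)
    finally show ?thesis .
  qed
  have nn_\<nu>: "(\<integral>\<^sup>+y. h y \<partial>\<nu>) = (\<integral>\<^sup>+y. p y * h y \<partial>L)" if [measurable]: "h \<in> borel_measurable T" for h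
  proof -
    have "(\<integral>\<^sup>+y. h y \<partial>\<nu>) = (\<integral>\<^sup>+z. h (snd z) \<partial>M)"
      unfolding \<nu>_def by (subst nn_integral_distr) (auto simp: case_prod_beta)
    also have "\<dots> = (\<integral>\<^sup>+x. \<integral>\<^sup>+y. ennreal (\<phi> (x, y)) * h y \<partial>L \<partial>P)"
      by (subst nn_M) auto
    also have "\<dots> = (\<integral>\<^sup>+y. \<integral>\<^sup>+x. ennreal (\<phi> (x, y)) * h y \<partial>P \<partial>L)"
      by (intro PL.Fubini'[symmetric]) measurable
    also have "\<dots> = (\<integral>\<^sup>+y. p y * h y \<partial>L)"
      unfolding p_def by (intro nn_integral_cong nn_integral_multc) measurable
    finally show ?thesis .
  qed
  have nn_prod: "(\<integral>\<^sup>+w. h w \<partial>(\<mu> \<Otimes>\<^sub>M \<nu>)) = (\<integral>\<^sup>+x. \<integral>\<^sup>+y. p y * h (U x, y) \<partial>L \<partial>P)"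
    if [measurable]: "h \<in> borel_measurable (S \<Otimes>\<^sub>M T)" for h
  proof -
    have "(\<integral>\<^sup>+w. h w \<partial>(\<mu> \<Otimes>\<^sub>M \<nu>)) = (\<integral>\<^sup>+u. \<integral>\<^sup>+y. h (u, y) \<partial>\<nu> \<partial>\<mu>)"
      by (rule \<nu>.nn_integral_fst[symmetric]) measurable
    also have "\<dots> = (\<integral>\<^sup>+x. \<integral>\<^sup>+y. h (U x, y) \<partial>\<nu> \<partial>P)"
      by (rule nn_\<mu>) measurable
    also have "\<dots> = (\<integral>\<^sup>+x. \<integral>\<^sup>+y. p y * h (U x, y) \<partial>L \<partial>P)"
      by (intro nn_integral_cong nn_\<nu>) measurable
    finally show ?thesis .
  qed
  have nn_Q: "(\<integral>\<^sup>+w. h w \<partial>Q) = (\<integral>\<^sup>+z. h (U (fst z), snd z) \<partial>M)"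
    if [measurable]: "h \<in> borel_measurable (S \<Otimes>\<^sub>M T)" for h
    unfolding Q_def by (subst nn_integral_distr) (auto simp: case_prod_beta)
  have sets_prod: "sets (\<mu> \<Otimes>\<^sub>M \<nu>) = sets (S \<Otimes>\<^sub>M T)"
    by (intro sets_pair_measure_cong) (simp_all add: \<mu>_def \<nu>_def)
  \<comment> \<open>The product of the marginals integrates a set against the positive weight
    \<open>p\<close>, so the preimage of a null set is null for
    \<open>P \<Otimes>\<^sub>M L\<close>. As \<open>M\<close> has a density there, it gives this
    preimage no mass.\<close>
  have ac: "absolutely_continuous (\<mu> \<Otimes>\<^sub>M \<nu>) Q"
    unfolding absolutely_continuous_def
  proof (rule subsetI)
    fix A assume A: "A \<in> null_sets (\<mu> \<Otimes>\<^sub>M \<nu>)"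
    then have [measurable]: "A \<in> sets (S \<Otimes>\<^sub>M T)"
      using sets_prod by auto
    have "0 = (\<integral>\<^sup>+w. indicator A w \<partial>(\<mu> \<Otimes>\<^sub>M \<nu>))"
      using A by (subst nn_integral_indicator) (auto simp: null_sets_def)
    also have "\<dots> = (\<integral>\<^sup>+x. \<integral>\<^sup>+y. p y * indicator A (U x, y) \<partial>L \<partial>P)"
      by (rule nn_prod) measurable
    also have "\<dots> = (\<integral>\<^sup>+z. p (snd z) * indicator A (U (fst z), snd z) \<partial>(P \<Otimes>\<^sub>M L))"
      by (subst L.nn_integral_fst[symmetric]) auto
    finally have "AE z in P \<Otimes>\<^sub>M L. p (snd z) * indicator A (U (fst z), snd z) = 0"
      by (subst nn_integral_0_iff_AE[symmetric]) auto
    then have AE0: "AE z in P \<Otimes>\<^sub>M L. (indicator A (U (fst z), snd z) :: ennreal) = 0"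
      using AE_space by eventually_elim (use p_pos in \<open>force simp: space_pair_measure\<close>)
    have "emeasure Q A = (\<integral>\<^sup>+w. indicator A w \<partial>Q)" by simp
    also have "\<dots> = (\<integral>\<^sup>+z. ennreal (\<phi> z) * indicator A (U (fst z), snd z) \<partial>(P \<Otimes>\<^sub>M L))"
      by (subst nn_Q) (auto simp: M nn_integral_density)
    also have "\<dots> = 0"
      using AE0 by (subst nn_integral_0_iff_AE) (auto elim: eventually_mono)
    finally show "A \<in> null_sets Q" by (auto simp: null_sets_def)
  qed
  have sets_Q: "sets Q = sets (\<mu> \<Otimes>\<^sub>M \<nu>)"
    by (simp add: Q_def sets_prod)
  \<comment> \<open>Real version of the Radon-Nikodym derivative, the form in which
    \<open>entropy_density\<close> takes its logarithm. Replacing infinity by 0 changes it only on a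
    null set.\<close>
  define r where "r w = enn2real (RN_deriv (\<mu> \<Otimes>\<^sub>M \<nu>) Q w)" for w
  have r[measurable]: "r \<in> borel_measurable (S \<Otimes>\<^sub>M T)"
  proof -
    have "r \<in> borel_measurable (\<mu> \<Otimes>\<^sub>M \<nu>)" unfolding r_def by measurable
    then show ?thesis using sets_Q by (simp add: Q_def cong: measurable_cong_sets)
  qed
  have r_nonneg: "r w \<ge> 0" for w by (simp add: r_def)
  have "AE w in \<mu> \<Otimes>\<^sub>M \<nu>. RN_deriv (\<mu> \<Otimes>\<^sub>M \<nu>) Q w \<noteq> \<infinity>"
    by (rule \<mu>\<nu>.P.RN_deriv_finite) (use ac sets_Q Q.sigma_finite_measure_axioms in auto)
  then have RN_eq: "AE w in \<mu> \<Otimes>\<^sub>M \<nu>. RN_deriv (\<mu> \<Otimes>\<^sub>M \<nu>) Q w = ennreal (r w)"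
    by eventually_elim (simp add: r_def less_top)
  have Q_dens: "Q = density (\<mu> \<Otimes>\<^sub>M \<nu>) (\<lambda>w. ennreal (r w))"
  proof -
    have "Q = density (\<mu> \<Otimes>\<^sub>M \<nu>) (RN_deriv (\<mu> \<Otimes>\<^sub>M \<nu>) Q)"
      using \<mu>\<nu>.P.density_RN_deriv[OF ac sets_Q] by simp
    also have "\<dots> = density (\<mu> \<Otimes>\<^sub>M \<nu>) (\<lambda>w. ennreal (r w))"
      by (rule density_cong) (use RN_eq in auto)
    finally show ?thesis .
  qed
  have nn_Qr: "(\<integral>\<^sup>+w. h w \<partial>Q) = (\<integral>\<^sup>+w. ennreal (r w) * h w \<partial>(\<mu> \<Otimes>\<^sub>M \<nu>))"
    if [measurable]: "h \<in> borel_measurable (S \<Otimes>\<^sub>M T)" for h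
    by (subst Q_dens, subst nn_integral_density) auto
  define R where "R z = r (U (fst z), snd z)" for z
  have R[measurable]: "R \<in> borel_measurable (P \<Otimes>\<^sub>M L)" unfolding R_def by measurable
  \<comment> \<open>A density is positive almost everywhere for the measure it defines, so the
    logarithms below have positive arguments \<open>M\<close>-almost everywhere.\<close>
  have "AE w in Q. r w > 0"
    by (subst Q_dens, subst AE_density) (auto simp: ennreal_less_zero_iff)
  then have R_pos: "AE z in M. R z > 0"
    unfolding Q_def by (subst (asm) AE_distr_iff) (auto simp: R_def case_prod_beta)

  \<comment> \<open>Controls the negative part of \<open>ln (R z)\<close>. Only an inequality holds:
    where \<open>r\<close> vanishes, \<open>1 / r\<close> is 0 by convention, and so is their
    product.\<close>
  have inv_le: "(\<integral>\<^sup>+z. ennreal (1 / R z) \<partial>M) \<le> 1"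
  proof -
    have "(\<integral>\<^sup>+z. ennreal (1 / R z) \<partial>M) = (\<integral>\<^sup>+w. ennreal (r w) * ennreal (1 / r w) \<partial>(\<mu> \<Otimes>\<^sub>M \<nu>))"
      unfolding R_def by (subst nn_Qr[symmetric], measurable, subst nn_Q) auto
    also have "\<dots> \<le> (\<integral>\<^sup>+w. 1 \<partial>(\<mu> \<Otimes>\<^sub>M \<nu>))"
      by (intro nn_integral_mono) (simp add: ennreal_mult'[symmetric] r_nonneg)
    finally show ?thesis by (simp add: \<mu>\<nu>.P.emeasure_space_1)
  qed
  \<comment> \<open>The factor \<open>\<phi>\<close> cancels against the density of
    \<open>M\<close>, leaving the integral of \<open>r\<close> times \<open>q\<close>. Writing
    \<open>q\<close> as \<open>p * (q / p)\<close> recreates the product of the marginals, where the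
    weight \<open>r\<close> turns the measure into \<open>Q\<close>. The remaining function
    \<open>q / p\<close> depends on the output alone, so its mean is the integral of
    \<open>q\<close>.\<close>
  have ratio_le: "(\<integral>\<^sup>+z. ennreal (R z * q (snd z) / \<phi> z) \<partial>M) \<le> 1"
  proof -
    have "(\<integral>\<^sup>+z. ennreal (R z * q (snd z) / \<phi> z) \<partial>M)
        = (\<integral>\<^sup>+x. \<integral>\<^sup>+y. ennreal (\<phi> (x, y)) * ennreal (R (x, y) * q y / \<phi> (x, y)) \<partial>L \<partial>P)"
      by (subst nn_M) auto
    also have "\<dots> = (\<integral>\<^sup>+x. \<integral>\<^sup>+y. p y * (ennreal (r (U x, y)) * (ennreal (q y) / p y)) \<partial>L \<partial>P)"
    proof (rule nn_integral_cong, rule nn_integral_cong_AE)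
      fix x assume "x \<in> space P"
      show "AE y in L. ennreal (\<phi> (x, y)) * ennreal (R (x, y) * q y / \<phi> (x, y))
          = p y * (ennreal (r (U x, y)) * (ennreal (q y) / p y))"
        using p_cancel
      proof eventually_elim
        case (elim y)
        have "ennreal (\<phi> (x, y)) * ennreal (R (x, y) * q y / \<phi> (x, y)) = ennreal (r (U x, y)) * ennreal (q y)"
          using \<phi>_pos[of "(x, y)"] q_pos[of y] r_nonneg
          by (simp add: ennreal_mult'[symmetric] R_def)
        then show ?case using elim by (metis mult.left_commute)
      qed
    qed
    also have "\<dots> = (\<integral>\<^sup>+w. ennreal (r w) * (ennreal (q (snd w)) / p (snd w)) \<partial>(\<mu> \<Otimes>\<^sub>M \<nu>))"
      by (subst nn_prod) auto
    also have "\<dots> = (\<integral>\<^sup>+w. ennreal (q (snd w)) / p (snd w) \<partial>Q)"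
      by (rule nn_Qr[symmetric]) measurable
    also have "\<dots> = (\<integral>\<^sup>+z. ennreal (q (snd z)) / p (snd z) \<partial>M)"
      by (subst nn_Q) auto
    also have "\<dots> = (\<integral>\<^sup>+y. ennreal (q y) / p y \<partial>\<nu>)"
      unfolding \<nu>_def by (subst nn_integral_distr) (auto simp: case_prod_beta)
    also have "\<dots> = (\<integral>\<^sup>+y. p y * (ennreal (q y) / p y) \<partial>L)"
      by (rule nn_\<nu>) measurable
    also have "\<dots> = (\<integral>\<^sup>+y. ennreal (q y) \<partial>L)"
      by (rule nn_integral_cong_AE[OF p_cancel])
    also have "\<dots> \<le> 1" by (rule q_le)
    finally show ?thesis .
  qed
  have int_inv: "integrable M (\<lambda>z. 1 / R z)"
    using inv_le r_nonneg by (intro integrableI_nonneg) (auto simp: R_def le_less_trans)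
  have int_ratio: "integrable M (\<lambda>z. R z * q (snd z) / \<phi> z)"
    using ratio_le r_nonneg q_pos \<phi>_pos
    by (intro integrableI_nonneg) (auto simp: R_def le_less_trans less_imp_le intro!: AE_I2)
  have E_ratio: "(\<integral>z. R z * q (snd z) / \<phi> z \<partial>M) \<le> 1"
    using ratio_le r_nonneg q_pos \<phi>_pos
    by (subst integral_eq_nn_integral) (auto simp: R_def less_imp_le intro!: AE_I2 enn2real_leI)

  have upper: "AE z in M. ln (R z) \<le> ln (\<phi> z / q (snd z)) + (R z * q (snd z) / \<phi> z - 1)"
    using R_pos
  proof eventually_elim
    case (elim z)
    have "ln (R z) - ln (\<phi> z / q (snd z)) = ln (R z * q (snd z) / \<phi> z)"
      using elim \<phi>_pos[of z] q_pos[of "snd z"] by (simp add: ln_mult ln_div)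
    also have "\<dots> \<le> R z * q (snd z) / \<phi> z - 1"
      using elim \<phi>_pos[of z] q_pos[of "snd z"] by (intro ln_le_minus_one) auto
    finally show ?case by simp
  qed
  have lower: "AE z in M. - ln (R z) \<le> 1 / R z - 1"
    using R_pos
  proof eventually_elim
    case (elim z)
    then show ?case using ln_le_minus_one[of "1 / R z"] by (simp add: ln_div)
  qed
  \<comment> \<open>The two one-sided bounds together dominate \<open>ln (R z)\<close> by an
    integrable function. With \<open>ac\<close>, this excludes the infinite branch of
    \<open>ext_mutual_information\<close>.\<close>
  have int_ln: "integrable M (\<lambda>z. ln (R z))"
  proof (rule Bochner_Integration.integrable_bound)
    show "integrable M (\<lambda>z. \<bar>ln (\<phi> z / q (snd z))\<bar> + R z * q (snd z) / \<phi> z + 1 / R z)"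
      using int int_ratio int_inv by auto
    show "AE z in M. norm (ln (R z)) \<le> norm (\<bar>ln (\<phi> z / q (snd z))\<bar> + R z * q (snd z) / \<phi> z + 1 / R z)"
      using R_pos upper lower
    proof eventually_elim
      case (elim z)
      have "0 \<le> R z * q (snd z) / \<phi> z" "0 \<le> 1 / R z"
        using elim(1) \<phi>_pos[of z] q_pos[of "snd z"] by auto
      then show ?case using elim(2,3) unfolding real_norm_def by linarith
    qed
  qed measurable
  have dens: "entropy_density (exp 1) (\<mu> \<Otimes>\<^sub>M \<nu>) Q = (\<lambda>w. ln (r w))"
    by (auto simp: entropy_density_def r_def fun_eq_iff log_def)
  have "integrable Q (entropy_density (exp 1) (\<mu> \<Otimes>\<^sub>M \<nu>) Q)"
    unfolding dens unfolding Q_def using int_ln by (subst integrable_distr_eq) (auto simp: R_def case_prod_beta)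
  then have "ext_mutual_information M S T (\<lambda>(x, y). U x) (\<lambda>(x, y). y)
      = ereal (M.mutual_information (exp 1) S T (\<lambda>(x, y). U x) (\<lambda>(x, y). y))"
    using ac by (simp add: ext_mutual_information_def Let_def \<mu>_def[symmetric] \<nu>_def[symmetric] Q_def[symmetric])
  also have "M.mutual_information (exp 1) S T (\<lambda>(x, y). U x) (\<lambda>(x, y). y) = (\<integral>w. ln (r w) \<partial>Q)"
    by (simp add: M.mutual_information_def KL_divergence_def dens \<mu>_def[symmetric] \<nu>_def[symmetric] Q_def[symmetric])
  also have "\<dots> = (\<integral>z. ln (R z) \<partial>M)"
    unfolding Q_def by (subst integral_distr) (auto simp: R_def case_prod_beta)
  also have "ereal (\<integral>z. ln (R z) \<partial>M) \<le> ereal (\<integral>z. ln (\<phi> z / q (snd z)) \<partial>M)"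
  proof -
    \<comment> \<open>As \<open>M\<close> is a probability measure, the correction term has mean at
      most \<open>1 - 1\<close> by \<open>E_ratio\<close>.\<close>
    have "(\<integral>z. ln (R z) \<partial>M) \<le> (\<integral>z. ln (\<phi> z / q (snd z)) + (R z * q (snd z) / \<phi> z - 1) \<partial>M)"
      using int int_ratio int_ln upper by (intro integral_mono_AE) auto
    also have "\<dots> = (\<integral>z. ln (\<phi> z / q (snd z)) \<partial>M) + ((\<integral>z. R z * q (snd z) / \<phi> z \<partial>M) - 1)"
      using int int_ratio by (simp add: M.prob_space)
    finally show ?thesis using E_ratio by simp
  qed
  finally show ?thesis .
qed

section \<open>Gaussian log-likelihood ratios\<close>

lemma ln_normal_density_ratio:
  assumes "\<sigma> > 0" "\<tau> > 0"
  shows "ln (normal_density a \<sigma> y / normal_density 0 \<tau> y)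
    = ln (\<tau> / \<sigma>) + y\<^sup>2 / (2 * \<tau>\<^sup>2) - (y - a)\<^sup>2 / (2 * \<sigma>\<^sup>2)"
proof -
  have "ln (normal_density m s y) = - (y - m)\<^sup>2 / (2 * s\<^sup>2) - ln s - ln (sqrt (2 * pi))" if "s > 0" for m s :: real
    using that by (simp add: normal_density_def ln_mult ln_div real_sqrt_mult)
  from this[OF assms(1), of a] this[OF assms(2), of 0] show ?thesis
    using assms normal_density_pos[OF assms(1), of a y] normal_density_pos[OF assms(2), of 0 y]
    by (simp add: ln_div)
qed

text \<open>Expanding \<open>y\<^sup>2\<close> about the mean \<open>a\<close> leaves only the
  central moments 1, 0 and \<open>\<sigma>\<^sup>2\<close>. The \<open>1 / 2\<close> is the mean of
  the quadratic exponent of the density itself. The constant \<open>c\<close> is free because both a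
  logarithm and its absolute value are inserted later.\<close>

lemma normal_log_ratio_moment:
  fixes a c \<sigma> \<tau> :: real
  assumes "\<sigma> > 0"
  shows "has_bochner_integral lborel
      (\<lambda>y. normal_density a \<sigma> y * (c + y\<^sup>2 / (2 * \<tau>\<^sup>2) - (y - a)\<^sup>2 / (2 * \<sigma>\<^sup>2)))
      (c + (\<sigma>\<^sup>2 + a\<^sup>2) / (2 * \<tau>\<^sup>2) - 1 / 2)"
proof -
  let ?n = "normal_density a \<sigma>"
  have m: "has_bochner_integral lborel ?n 1"
    "has_bochner_integral lborel (\<lambda>y. ?n y * (y - a)) 0"
    "has_bochner_integral lborel (\<lambda>y. ?n y * (y - a)\<^sup>2) (\<sigma>\<^sup>2)"
    using assms normal_moment_even[OF assms, of a 1] normal_moment_odd[OF assms, of a 0]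
    by (simp_all add: has_bochner_integral_iff fact_numeral)
  have "has_bochner_integral lborel
      (\<lambda>y. (c + a\<^sup>2 / (2 * \<tau>\<^sup>2)) * ?n y + a / \<tau>\<^sup>2 * (?n y * (y - a))
        + (1 / (2 * \<tau>\<^sup>2) - 1 / (2 * \<sigma>\<^sup>2)) * (?n y * (y - a)\<^sup>2))
      ((c + a\<^sup>2 / (2 * \<tau>\<^sup>2)) * 1 + a / \<tau>\<^sup>2 * 0 + (1 / (2 * \<tau>\<^sup>2) - 1 / (2 * \<sigma>\<^sup>2)) * \<sigma>\<^sup>2)"
    by (intro has_bochner_integral_add has_bochner_integral_mult_right m)
  moreover have "?n y * (c + y\<^sup>2 / (2 * \<tau>\<^sup>2) - (y - a)\<^sup>2 / (2 * \<sigma>\<^sup>2))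
     = (c + a\<^sup>2 / (2 * \<tau>\<^sup>2)) * ?n y + a / \<tau>\<^sup>2 * (?n y * (y - a))
        + (1 / (2 * \<tau>\<^sup>2) - 1 / (2 * \<sigma>\<^sup>2)) * (?n y * (y - a)\<^sup>2)" for y
  proof -
    \<comment> \<open>For \<open>\<tau> = 0\<close> every quotient is 0 by convention and both sides
      vanish.\<close>
    have "y\<^sup>2 / (2 * \<tau>\<^sup>2) = a\<^sup>2 / (2 * \<tau>\<^sup>2) + a / \<tau>\<^sup>2 * (y - a) + 1 / (2 * \<tau>\<^sup>2) * (y - a)\<^sup>2"
      by (cases "\<tau> = 0") (auto simp: field_simps power2_eq_square)
    \<comment> \<open>Bare letters let \<open>simp only\<close> match term by term:
      \<open>A\<close>, \<open>B\<close>, \<open>C\<close> are the coefficients just found,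
      \<open>w\<close> is the deviation from the mean, \<open>v\<close> its square and
      \<open>K\<close> twice the variance.\<close>
    moreover have "m * (c + (A + B * w + C * v) - v / K) = (c + A) * m + B * (m * w) + (C - 1 / K) * (m * v)"
      for m A B C v w K :: real by (simp add: algebra_simps)
    ultimately show ?thesis by (simp only:)
  qed
  moreover have "(c + a\<^sup>2 / (2 * \<tau>\<^sup>2)) * 1 + a / \<tau>\<^sup>2 * 0 + (1 / (2 * \<tau>\<^sup>2) - 1 / (2 * \<sigma>\<^sup>2)) * \<sigma>\<^sup>2
      = c + (\<sigma>\<^sup>2 + a\<^sup>2) / (2 * \<tau>\<^sup>2) - 1 / 2"
    using assms by (simp add: algebra_simps add_divide_distrib)
  ultimately show ?thesis by (simp only:)
qed

text \<open>The reference variance \<open>T\<^sup>2 + N\<close> bounds the second moment of the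
  output for every input. The reference exponent therefore contributes at most \<open>1 / 2\<close>,
  which cancels the \<open>- 1 / 2\<close> of the channel exponent, and only the logarithm of the
  ratio of standard deviations survives.\<close>

lemma gaussian_expected_log_ratio:
  fixes F :: "'a \<Rightarrow> real" and T N :: real
  assumes "prob_space P" and F[measurable]: "F \<in> borel_measurable P"
    and bound: "\<And>x. x \<in> space P \<Longrightarrow> \<bar>F x\<bar> \<le> T" and N: "N > 0"
    and M: "M = density (P \<Otimes>\<^sub>M lborel) (\<lambda>z. ennreal (normal_density (F (fst z)) (sqrt N) (snd z)))"
  defines "g \<equiv> \<lambda>z. ln (normal_density (F (fst z)) (sqrt N) (snd z)
                         / normal_density 0 (sqrt (T\<^sup>2 + N)) (snd z))"
  shows "integrable M g" and "(\<integral>z. g z \<partial>M) \<le> ln (1 + T\<^sup>2 / N) / 2"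
proof -
  interpret P: prob_space P by fact
  interpret PL: pair_sigma_finite P lborel ..
  define s where "s = T\<^sup>2 + N"
  define c where "c = ln (sqrt s / sqrt N)"
  have s: "s > 0" "N \<le> s" using N by (simp_all add: s_def add_nonneg_pos)
  let ?n = "\<lambda>x. normal_density (F x) (sqrt N)"
  define h where "h z = ?n (fst z) (snd z) * g z" for z
  have n_meas[measurable]: "(\<lambda>z. ?n (fst z) (snd z)) \<in> borel_measurable (P \<Otimes>\<^sub>M lborel)"
    unfolding normal_density_def by measurable
  have g_meas[measurable]: "g \<in> borel_measurable (P \<Otimes>\<^sub>M lborel)"
    unfolding g_def by measurable
  have g_eq: "g (x, y) = c + y\<^sup>2 / (2 * s) - (y - F x)\<^sup>2 / (2 * N)" for x y
    using ln_normal_density_ratio[of "sqrt N" "sqrt s" "F x" y] s N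
    by (simp add: g_def c_def s_def[symmetric])
  have h_fst: "has_bochner_integral lborel (\<lambda>y. h (x, y)) (c + (N + (F x)\<^sup>2) / (2 * s) - 1 / 2)" for x
    using normal_log_ratio_moment[of "sqrt N" "F x" c "sqrt s"] N s by (simp add: h_def g_eq)
  have F2: "(F x)\<^sup>2 \<le> T\<^sup>2" if "x \<in> space P" for x
    using power_mono[OF bound[OF that] abs_ge_zero, of 2] by simp
  \<comment> \<open>A bound uniform in \<open>x\<close> gives integrability over the probability
    measure \<open>P\<close>. Starting from \<open>\<bar>c\<bar>\<close> and adding
    \<open>(y - F x)\<^sup>2 / N\<close>, twice the subtracted quadratic, makes all signs positive.
    The means then sum to at most \<open>\<bar>c\<bar> + 1\<close>, inside the stated bound.\<close>
  have abs_fst: "(\<integral>y. norm (h (x, y)) \<partial>lborel) \<le> \<bar>c\<bar> + 2" if x: "x \<in> space P" for x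
  proof -
    have i: "has_bochner_integral lborel (\<lambda>y. ?n x y * (\<bar>c\<bar> + y\<^sup>2 / (2 * s) - (y - F x)\<^sup>2 / (2 * N)))
      (\<bar>c\<bar> + (N + (F x)\<^sup>2) / (2 * s) - 1 / 2)"
      using normal_log_ratio_moment[of "sqrt N" "F x" "\<bar>c\<bar>" "sqrt s"] N s by simp
    have j: "has_bochner_integral lborel (\<lambda>y. ?n x y * (y - F x)\<^sup>2) N"
      using normal_moment_even[of "sqrt N" "F x" 1] N by (simp add: fact_numeral)
    have k: "has_bochner_integral lborel
        (\<lambda>y. ?n x y * (\<bar>c\<bar> + y\<^sup>2 / (2 * s) - (y - F x)\<^sup>2 / (2 * N)) + 1 / N * (?n x y * (y - F x)\<^sup>2))
        (\<bar>c\<bar> + (N + (F x)\<^sup>2) / (2 * s) - 1 / 2 + 1 / N * N)"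
      by (intro has_bochner_integral_add has_bochner_integral_mult_right i j)
    have "(\<integral>y. norm (h (x, y)) \<partial>lborel) \<le> \<bar>c\<bar> + (N + (F x)\<^sup>2) / (2 * s) - 1 / 2 + 1 / N * N"
    proof (rule has_bochner_integral_integral_eq[OF k, THEN eq_refl, THEN order.trans[rotated]], rule integral_mono)
      show "integrable lborel (\<lambda>y. norm (h (x, y)))"
        using h_fst by (auto simp: has_bochner_integral_iff)
      show "integrable lborel (\<lambda>y. ?n x y * (\<bar>c\<bar> + y\<^sup>2 / (2 * s) - (y - F x)\<^sup>2 / (2 * N)) + 1 / N * (?n x y * (y - F x)\<^sup>2))"
        using k by (auto simp: has_bochner_integral_iff)
      fix y
      have "0 \<le> y\<^sup>2 / (2 * s)" "0 \<le> (y - F x)\<^sup>2 / (2 * N)" using s N by auto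
      then have "\<bar>g (x, y)\<bar> \<le> \<bar>c\<bar> + y\<^sup>2 / (2 * s) + (y - F x)\<^sup>2 / (2 * N)"
        unfolding g_eq by linarith
      then have "?n x y * \<bar>g (x, y)\<bar> \<le> ?n x y * (\<bar>c\<bar> + y\<^sup>2 / (2 * s) + (y - F x)\<^sup>2 / (2 * N))"
        by (intro mult_left_mono) auto
      then show "norm (h (x, y)) \<le> ?n x y * (\<bar>c\<bar> + y\<^sup>2 / (2 * s) - (y - F x)\<^sup>2 / (2 * N))
          + 1 / N * (?n x y * (y - F x)\<^sup>2)"
        by (simp add: h_def abs_mult algebra_simps)
    qed
    also have "\<dots> \<le> \<bar>c\<bar> + 2"
      using F2[OF x] s N by (simp add: field_simps s_def)
    finally show ?thesis .
  qed
  have h_meas[measurable]: "h \<in> borel_measurable (P \<Otimes>\<^sub>M lborel)"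
    unfolding h_def by measurable
  have int_h: "integrable (P \<Otimes>\<^sub>M lborel) h"
  proof (rule PL.Fubini_integrable)
    show "integrable P (\<lambda>x. \<integral>y. norm (h (x, y)) \<partial>lborel)"
      by (rule P.integrable_const_bound[where B="\<bar>c\<bar> + 2"]) (use abs_fst in \<open>auto intro!: AE_I2\<close>)
    show "AE x in P. integrable lborel (\<lambda>y. h (x, y))"
      using h_fst by (auto simp: has_bochner_integral_iff)
  qed measurable
  show "integrable M g"
    using int_h unfolding M by (subst integrable_real_density) (auto simp: h_def[abs_def])
  have "(\<integral>z. g z \<partial>M) = (\<integral>z. h z \<partial>(P \<Otimes>\<^sub>M lborel))"
    unfolding M by (subst integral_real_density) (auto simp: h_def[abs_def])
  also have "\<dots> = (\<integral>x. \<integral>y. h (x, y) \<partial>lborel \<partial>P)"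
    by (rule PL.integral_fst'[OF int_h, symmetric])
  also have "\<dots> \<le> (\<integral>x. c \<partial>P)"
  proof (rule integral_mono)
    show "integrable P (\<lambda>x. \<integral>y. h (x, y) \<partial>lborel)" by (rule PL.integrable_fst'[OF int_h])
    show "(\<integral>y. h (x, y) \<partial>lborel) \<le> c" if "x \<in> space P" for x
    proof -
      have "(N + (F x)\<^sup>2) / (2 * s) \<le> 1 / 2"
        using F2[OF that] s by (simp add: field_simps s_def)
      then show ?thesis using has_bochner_integral_integral_eq[OF h_fst, of x] by linarith
    qed
  qed simp
  also have "\<dots> = c" by (simp add: P.prob_space)
  also have "c = ln (1 + T\<^sup>2 / N) / 2"
  proof -
    have "sqrt s / sqrt N = sqrt (1 + T\<^sup>2 / N)"
      using N by (simp add: s_def real_sqrt_divide[symmetric] add_divide_distrib add.commute)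
    then show ?thesis using N by (simp add: c_def ln_sqrt add_pos_nonneg)
  qed
  finally show "(\<integral>z. g z \<partial>M) \<le> ln (1 + T\<^sup>2 / N) / 2" .
qed

section \<open>Topology and measurability of the input space\<close>

text \<open>Reconciles the product of subspaces of Euclidean spaces, where continuity of
  \<open>f\<close> is given, with the type-class topology on functions. The identity on the alphabet
  is continuous from the latter to the former because each coordinate is, and composing with it
  transfers continuity.\<close>

lemma input_continuous_on:
  assumes "continuous_map (input_topology n d X) euclideanreal f"
    and "\<And>i. i \<in> {1..n} \<Longrightarrow> X i \<subseteq> topspace (Euclidean_space (d i))"
  shows "continuous_on (input_alphabet n X) f"
proof -
  have "continuous_map (top_of_set (input_alphabet n X)) (input_topology n d X) (\<lambda>x. x)"
    unfolding input_topology_def continuous_map_componentwise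
  proof (intro conjI ballI)
    show "(\<lambda>x. x) ` topspace (top_of_set (input_alphabet n X)) \<subseteq> extensional {1..n}"
      by (auto simp: input_alphabet_def PiE_def)
    fix i assume i: "i \<in> {1..n}"
    have "continuous_map (top_of_set (input_alphabet n X)) (powertop_real UNIV) (\<lambda>x. x i)"
      using continuous_on_product_then_coordinatewise[OF continuous_on_id, of _ i]
      by (simp only: euclidean_product_topology continuous_map_iff_continuous id_apply)
    moreover have "x i \<in> X i" "x i \<in> {x. \<forall>j\<ge>d i. x j = 0}" if "x \<in> input_alphabet n X" for x
      using PiE_mem[OF that[unfolded input_alphabet_def] i] assms(2)[OF i]
      by (auto simp: topspace_Euclidean_space)
    ultimately show "continuous_map (top_of_set (input_alphabet n X))
        (subtopology (Euclidean_space (d i)) (X i)) (\<lambda>x. x i)"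
      by (auto simp: Euclidean_space_def continuous_map_in_subtopology)
  qed
  from continuous_map_compose[OF this assms(1)] show ?thesis by (simp add: comp_def)
qed


text \<open>\<open>Euclidean_space\<close> consists of the real sequences vanishing from index
  \<open>d i\<close> on, with the topology inherited from all sequences. The trace of an open set is
  thus one of the generators of \<open>borel_Euclidean\<close>.\<close>

lemma coordinate_measurable_borel: "(\<lambda>x. x) \<in> coordinate_space d X i \<rightarrow>\<^sub>M borel"
  unfolding coordinate_space_def
proof (rule measurable_restrict_space1, rule borel_measurableI)
  fix S :: "(nat \<Rightarrow> real) set" assume "open S"
  then have "openin (Euclidean_space (d i)) (topspace (Euclidean_space (d i)) \<inter> S)"
    by (auto simp: Euclidean_space_def openin_subtopology euclidean_product_topology)
  then have "topspace (Euclidean_space (d i)) \<inter> S \<in> sets (borel_Euclidean (d i))"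
    unfolding borel_Euclidean_def
    by (subst sets_measure_of) (auto dest: openin_subset)
  then show "(\<lambda>x. x) -` S \<inter> space (borel_Euclidean (d i)) \<in> sets (borel_Euclidean (d i))"
    unfolding borel_Euclidean_def
    by (subst space_measure_of) (auto dest: openin_subset simp: Int_commute)
qed

text \<open>Over a countable index set the product of Borel algebras is the Borel algebra of the
  function space. Measurability of the inclusion therefore reduces to single coordinates, and
  \<open>f\<close>, continuous on the alphabet, is composed with it.\<close>

lemma borel_measurable_input:
  assumes "\<And>i. i \<in> {1..n} \<Longrightarrow> X i \<in> sets (borel_Euclidean (d i))"
    and "continuous_map (input_topology n d X) euclideanreal f"
  shows "f \<in> borel_measurable (\<Pi>\<^sub>M i\<in>{1..n}. coordinate_space d X i)"
    and "space (\<Pi>\<^sub>M i\<in>{1..n}. coordinate_space d X i) = input_alphabet n X"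
proof -
  let ?P = "\<Pi>\<^sub>M i\<in>{1..n}. coordinate_space d X i"
  have space_E: "space (borel_Euclidean k) = topspace (Euclidean_space k)" for k
    unfolding borel_Euclidean_def by (rule space_measure_of) (auto dest: openin_subset)
  have sub: "X i \<subseteq> topspace (Euclidean_space (d i))" if "i \<in> {1..n}" for i
    using sets.sets_into_space[OF assms(1)[OF that]] by (simp add: space_E)
  then have "space (coordinate_space d X i) = X i" if "i \<in> {1..n}" for i
    using that by (auto simp: coordinate_space_def space_restrict_space space_E)
  then show space_P: "space ?P = input_alphabet n X"
    by (auto simp: space_PiM input_alphabet_def intro!: PiE_cong)
  have "(\<lambda>x. x) \<in> ?P \<rightarrow>\<^sub>M (\<Pi>\<^sub>M i\<in>UNIV. borel)"
  proof (rule measurable_PiM_single')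
    fix i :: nat
    show "(\<lambda>x. x i) \<in> ?P \<rightarrow>\<^sub>M borel"
    proof (cases "i \<in> {1..n}")
      case True
      from measurable_compose[OF measurable_component_singleton[OF this] coordinate_measurable_borel]
      show ?thesis .
    next
      \<comment> \<open>Inputs are extensional, so a coordinate outside \<open>{1..n}\<close> is the
        constant \<open>undefined\<close>.\<close>
      case False
      then have "x i = undefined" if "x \<in> space ?P" for x
        using that by (auto simp: space_PiM PiE_def extensional_def)
      then show ?thesis by (subst measurable_cong[where g="\<lambda>_. undefined"]) auto
    qed
  qed auto
  then have "(\<lambda>x. x) \<in> ?P \<rightarrow>\<^sub>M borel"
    using sets_PiM_equal_borel measurable_cong_sets by blast
  then have "(\<lambda>x. x) \<in> ?P \<rightarrow>\<^sub>M restrict_space borel (input_alphabet n X)"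
    by (rule measurable_restrict_space2[rotated]) (use space_P in auto)
  from measurable_compose[OF this borel_measurable_continuous_on_restrict[OF input_continuous_on[OF assms(2) sub]]]
  show "f \<in> borel_measurable ?P" by simp
qed

section \<open>Capacity bound for the Gaussian channel\<close>

theorem mainTheorem6:
  fixes n :: nat
    and d :: "nat \<Rightarrow> nat"
    and X :: "nat \<Rightarrow> (nat \<Rightarrow> real) set"
    and f :: "(nat \<Rightarrow> nat \<Rightarrow> real) \<Rightarrow> real"
    and T \<epsilon> N :: real
  assumes "n \<ge> 1"
    and "\<And>i. i \<in> {1..n} \<Longrightarrow> X i \<in> sets (borel_Euclidean (d i))"
    and "T > 0"
    and "continuous_map (input_topology n d X) euclideanreal f"
    and "f ` input_alphabet n X \<subseteq> {-T..T}"
    and "\<epsilon> > 0"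
    and "N > 0"
    and "N \<ge> T\<^sup>2 / (exp (2 * \<epsilon>) - 1)"
  shows "information_private \<epsilon> n (coordinate_space d X)
           (all_distributions n (coordinate_space d X)) (gaussian_channel f N)"
proof -
  define S where "S = coordinate_space d X"
  \<comment> \<open>The capacity is a supremum, so a bound uniform in the coordinate and the input
    law suffices.\<close>
  have bound: "ext_mutual_information (channel_law P (gaussian_channel f N)) (S i) borel
      (\<lambda>(x, y). x i) (\<lambda>(x, y). y) \<le> ereal \<epsilon>"
    if i: "i \<in> {1..n}" and P: "P \<in> all_distributions n S" for i P
  proof -
    have "prob_space P" and sets_P[measurable_cong]: "sets P = sets (\<Pi>\<^sub>M i\<in>{1..n}. S i)"
      using P by (auto simp: all_distributions_def)
    note space_P = sets_eq_imp_space_eq[OF sets_P]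
    have f[measurable]: "f \<in> borel_measurable P"
      using borel_measurable_input[OF assms(2,4)] measurable_cong_sets[OF sets_P refl]
      unfolding S_def by blast
    have f_bound: "\<bar>f x\<bar> \<le> T" if "x \<in> space P" for x
    proof -
      have "x \<in> input_alphabet n X"
        using that borel_measurable_input(2)[OF assms(2,4)] space_P unfolding S_def by blast
      then show ?thesis using assms(5) by fastforce
    qed
    define \<phi> where "\<phi> z = normal_density (f (fst z)) (sqrt N) (snd z)" for z
    define q where "q = normal_density 0 (sqrt (T\<^sup>2 + N))"
    define M where "M = density (P \<Otimes>\<^sub>M lborel) (\<lambda>z. ennreal (\<phi> z))"
    have \<phi>[measurable]: "\<phi> \<in> borel_measurable (P \<Otimes>\<^sub>M lborel)"
      unfolding \<phi>_def[abs_def] normal_density_def by measurable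
    have s: "T\<^sup>2 + N > 0" using \<open>N > 0\<close> by (simp add: add_nonneg_pos)
    have normalized: "(\<integral>\<^sup>+y. ennreal (normal_density m \<sigma> y) \<partial>lborel) = 1" if "\<sigma> > 0" for m \<sigma>
      using that by (simp add: nn_integral_eq_integral)
    have law: "channel_law P (gaussian_channel f N) = M"
      unfolding M_def
      by (rule channel_law_density[OF \<open>prob_space P\<close> \<phi>])
        (use \<open>N > 0\<close> in \<open>simp_all add: gaussian_channel_def \<phi>_def normalized\<close>)
    have M_eq: "M = density (P \<Otimes>\<^sub>M lborel) (\<lambda>z. ennreal (normal_density (f (fst z)) (sqrt N) (snd z)))"
      by (simp add: M_def \<phi>_def)
    note log_ratio = gaussian_expected_log_ratio[OF \<open>prob_space P\<close> f f_bound \<open>N > 0\<close> M_eq,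
        folded \<phi>_def q_def]
    have "ext_mutual_information M (S i) borel (\<lambda>(x, y). x i) (\<lambda>(x, y). y)
        \<le> ereal (\<integral>z. ln (\<phi> z / q (snd z)) \<partial>M)"
    proof (rule ext_mutual_information_le[where P=P and L=lborel])
      show "(\<lambda>x. x i) \<in> P \<rightarrow>\<^sub>M S i"
        using i by measurable
      show "(\<integral>\<^sup>+y. ennreal (q y) \<partial>lborel) \<le> 1"
        using s by (simp add: q_def normalized)
      show "(\<integral>\<^sup>+y. ennreal (\<phi> (x, y)) \<partial>lborel) = 1" for x
        using \<open>N > 0\<close> by (simp add: \<phi>_def normalized)
      show "\<phi> z > 0" for z using \<open>N > 0\<close> by (simp add: \<phi>_def normal_density_pos)
      show "q y > 0" for y using s by (simp add: q_def normal_density_pos)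
      show "q \<in> borel_measurable lborel" by (simp add: q_def)
    qed (use \<open>prob_space P\<close> \<phi> M_def log_ratio lborel.sigma_finite_measure_axioms in auto)
    also have "\<dots> \<le> ereal (ln (1 + T\<^sup>2 / N) / 2)"
      using log_ratio(2) by simp
    also have "\<dots> \<le> ereal \<epsilon>"
    proof -
      \<comment> \<open>Since \<open>\<epsilon> > 0\<close>, the denominator
        \<open>exp (2 * \<epsilon>) - 1\<close> is positive and can be cleared. The bound on
        \<open>N\<close> then says exactly that half the logarithm is at most
        \<open>\<epsilon>\<close>.\<close>
      have "T\<^sup>2 \<le> N * (exp (2 * \<epsilon>) - 1)"
        using assms(6,8) by (simp add: pos_divide_le_eq)
      then have "1 + T\<^sup>2 / N \<le> exp (2 * \<epsilon>)"
        using \<open>N > 0\<close> by (simp add: field_simps)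
      then have "ln (1 + T\<^sup>2 / N) \<le> 2 * \<epsilon>"
        using \<open>N > 0\<close> by (metis add_pos_nonneg exp_gt_zero ln_exp ln_le_cancel_iff
            divide_nonneg_pos zero_le_power2 zero_less_one)
      then show ?thesis by simp
    qed
    finally show ?thesis unfolding law .
  qed
  then show ?thesis
    unfolding information_private_def individual_capacity_def S_def[symmetric]
    by (intro SUP_least) auto
qed

end
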